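(* Let $W$ be the Lambert-$W$ function and let $d\ge1$ be fixed. Then: (a) $R_k(z)^{1/(k+1)}\sim e\,z/(k+1)$ as $k\to\infty$, where $z=z_k>0$ may depend on $k$, provided $z\le c(k+1)$ for all large $k$ and some $c\in(0,1)$; (b) $H_k(1)\sim W(1/e)\,(k+1)$ as $k\to\infty$; (c) $G_{k,d}(1)\sim\frac1e(k+1)$ as $k\to\infty$; (d) $C(k,d)\sim\frac1e(k+1)$ as $k\to\infty$, where $C(k,d)=\max\{H_k(1),G_{k,d}(1)\}$.
   Context: For $k\in\mathbb{N}_0$ and $z\in(0,\infty)$: $R_k(z)=e^z-\sum_{r=0}^k\frac{z^r}{r!}$, $\sigma_d^*(z)=\frac{z+\sqrt{z(d+z)}}{d}$, $h_k(z)=e^zR_k(z)$, $g_{k,d}(z)=(1+2\sigma_d^*(z))^{d/2}\exp(z/\sigma_d^*(z))R_k(z)$. Both $h_k$ and $g_{k,d}$ increase monotonically from limit $0$ at $0^+$ to $\infty$; $H_k$ and $G_{k,d}$ denote their inverse functions on $(0,\infty)$. $a_k\sim b_k$ means $a_k/b_k\to1$. $W$ is the principal branch: for $y>0$, $W(y)$ is the unique positive solution $w$ of $we^w=y$. *)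

theory Defs
  imports Complex_Main "HOL-Library.Landau_Symbols"
begin

definition R :: "nat \<Rightarrow> real \<Rightarrow> real" where
  "R k z = exp z - (\<Sum>r\<le>k. z ^ r / fact r)"

definition sigma_star :: "real \<Rightarrow> real \<Rightarrow> real" where
  "sigma_star d z = (z + sqrt (z * (d + z))) / d"

definition h :: "nat \<Rightarrow> real \<Rightarrow> real" where
  "h k z = exp z * R k z"

definition g :: "nat \<Rightarrow> real \<Rightarrow> real \<Rightarrow> real" where
  "g k d z = (1 + 2 * sigma_star d z) powr (d / 2) * exp (z / sigma_star d z) * R k z"

text \<open>Both \<open>h k\<close> and, for \<open>d > 0\<close>, \<open>g k d\<close> map the positive reals bijectively onto
  themselves, so the inverses below are determined at positive arguments; elsewhere their
  values are unspecified.\<close>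

definition H :: "nat \<Rightarrow> real \<Rightarrow> real" where
  "H k = the_inv_into {0<..} (h k)"

definition G :: "nat \<Rightarrow> real \<Rightarrow> real \<Rightarrow> real" where
  "G k d = the_inv_into {0<..} (g k d)"

definition C :: "nat \<Rightarrow> real \<Rightarrow> real" where
  "C k d = max (H k 1) (G k d 1)"

text \<open>Principal branch of the Lambert function, meaningful for \<open>y > 0\<close> only.\<close>

definition lambert_W :: "real \<Rightarrow> real" where
  "lambert_W y = (THE w. w > 0 \<and> w * exp w = y)"

end

theory Submission
  imports Defs "HOL-Real_Asymp.Real_Asymp"
begin

text \<open>
  Write \<open>n = k + 1\<close>. Everything rests on a two-sided estimate for the exponential remainder
  (\<open>R_bounds\<close>): if \<open>0 < z \<le> c n\<close> with \<open>0 < c < 1\<close>, then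
  \<open>(e z / n)^n / (e n) \<le> R k z \<le> (e z / n)^n / (1 - c)\<close>. Indeed \<open>R k z\<close> is the tail of the
  exponential series starting with \<open>z^n / n!\<close>; on this range the ratio of consecutive terms is
  at most \<open>c\<close>, so the tail is comparable to its first term, and
  \<open>(n / e)^n \<le> n! \<le> e n (n / e)^n\<close> is all of Stirling's formula that is needed. The factors
  \<open>1 / (e n)\<close> and \<open>1 / (1 - c)\<close> disappear under \<open>n\<close>-th roots, which gives (a).

  For (b) and (c), both \<open>h k\<close> and \<open>g k d\<close> have the form \<open>P z * R k z\<close>, with \<open>P\<close> positive,
  increasing and independent of \<open>k\<close>. Such a product is strictly increasing in \<open>z\<close>, so the point
  where it equals 1 can be located by testing it on the rays \<open>z = l n\<close>: by the estimate its
  value there is \<open>P (l n) (e l)^n\<close> up to a factor of order at most \<open>n\<close>. If this tends to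
  0 for \<open>l < \<theta>\<close>, and to infinity faster than \<open>n\<close> for \<open>\<theta> < l < 1\<close>, the point is
  asymptotic to \<open>\<theta> n\<close> (\<open>inverse_at_1_asymp\<close>). For \<open>P = exp\<close> the value is
  \<open>(e l exp l)^n\<close> and the critical \<open>\<theta>\<close> solves \<open>\<theta> exp \<theta> = 1 / e\<close>. For \<open>g\<close> the
  factor \<open>P\<close> lies between 1 and \<open>exp d (4 z + 3)^(d / 2)\<close>, so it does not influence the
  exponential rate, and \<open>\<theta> = 1 / e\<close>. Finally \<open>W (1 / e) < 1 / e\<close>, so the maximum in (d)
  is governed by (c).
\<close>

section \<open>The remainder of the exponential series\<close>

lemma R_eq_next: "R k z = z ^ (k + 1) / fact (k + 1) + R (k + 1) z"
  by (simp add: R_def)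

lemma R_sums: "(\<lambda>j. z ^ (j + (k + 1)) / fact (j + (k + 1))) sums R k z"
proof -
  have "(\<lambda>n. z ^ n / fact n) sums exp z"
    using exp_converges[of z] by (simp add: field_simps)
  from sums_split_initial_segment[OF this, of "k + 1"] show ?thesis
    by (simp add: R_def lessThan_Suc_atMost)
qed

lemma R_nonneg: "z \<ge> 0 \<Longrightarrow> R k z \<ge> 0"
  by (rule sums_le[OF _ sums_zero R_sums]) auto

lemma R_mono: "0 \<le> x \<Longrightarrow> x \<le> y \<Longrightarrow> R k x \<le> R k y"
  by (rule sums_le[OF _ R_sums R_sums]) (auto intro!: divide_right_mono power_mono simp del: power_Suc fact_Suc)

lemma R_strict_mono:
  assumes "0 \<le> x" "x < y"
  shows "R k x < R k y"
proof -
  have "x ^ (k + 1) / fact (k + 1) < y ^ (k + 1) / fact (k + 1)"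
    using assms by (intro divide_strict_right_mono power_strict_mono) auto
  moreover have "R (k + 1) x \<le> R (k + 1) y"
    using assms by (intro R_mono) auto
  ultimately show ?thesis
    unfolding R_eq_next[of k] by linarith
qed

lemma R_ge_first_term: "z \<ge> 0 \<Longrightarrow> z ^ (k + 1) / fact (k + 1) \<le> R k z"
  using R_nonneg[of z "k + 1"] R_eq_next[of k z] by linarith

lemma R_pos: "z > 0 \<Longrightarrow> R k z > 0"
  by (rule less_le_trans[OF _ R_ge_first_term]) auto

lemma continuous_on_R: "continuous_on A (R k)"
  unfolding R_def by (intro continuous_intros) auto

text \<open>The ratio of consecutive terms of the tail is \<open>z / (n + j)\<close> with \<open>n = k + 1\<close> and
  \<open>j \<ge> 1\<close>, hence at most \<open>c\<close>; a geometric series dominates.\<close>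

lemma R_le_first_term:
  assumes "0 < z" "z \<le> c * real (k + 1)" "0 < c" "c < 1"
  shows "R k z \<le> z ^ (k + 1) / fact (k + 1) / (1 - c)"
proof -
  let ?a = "z ^ (k + 1) / fact (k + 1)"
  have term_le: "z ^ (j + (k + 1)) / fact (j + (k + 1)) \<le> ?a * c ^ j" for j
  proof (induction j)
    case (Suc j)
    have "z \<le> c * real (Suc j + (k + 1))"
      using assms by (intro order_trans[OF assms(2)] mult_left_mono) auto
    hence ratio: "z / real (Suc j + (k + 1)) \<le> c"
      by (simp add: field_simps)
    have "z ^ (Suc j + (k + 1)) / fact (Suc j + (k + 1)) =
            z ^ (j + (k + 1)) / fact (j + (k + 1)) * (z / real (Suc j + (k + 1)))"
      by (simp add: mult_ac)
    also have "\<dots> \<le> (?a * c ^ j) * c"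
      using assms by (intro mult_mono Suc.IH ratio) auto
    finally show ?case by (simp add: mult_ac)
  qed simp
  have "(\<lambda>j. ?a * c ^ j) sums (?a * (1 / (1 - c)))"
    using assms by (intro sums_mult geometric_sums) auto
  from sums_le[OF term_le R_sums this] show ?thesis by simp
qed

lemma power_div_exp_le_fact: "(real n / exp 1) ^ n \<le> fact n"
proof -
  have "real n ^ n / fact n \<le> exp (real n)"
  proof -
    have s: "(\<lambda>m. real n ^ m / fact m) sums exp (real n)"
      using exp_converges[of "real n"] by (simp add: field_simps)
    have "(\<Sum>m\<in>{n}. real n ^ m / fact m) \<le> (\<Sum>m. real n ^ m / fact m)"
      by (rule sum_le_suminf) (use s in \<open>auto simp: sums_iff\<close>)
    with s show ?thesis by (simp add: sums_iff)
  qed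
  thus ?thesis
    by (simp add: power_divide field_simps flip: exp_of_nat_mult)
qed

text \<open>Induction on \<open>n\<close>: the right-hand side grows by the factor
  \<open>(n + 1) (1 + 1 / n)^(n + 1) / e\<close>, which is at least \<open>n + 1\<close> because
  \<open>ln (1 + 1 / n) \<ge> 1 / (n + 1)\<close>.\<close>

lemma fact_le_power_div_exp:
  assumes "n > 0"
  shows "fact n \<le> exp 1 * real n * (real n / exp 1) ^ n"
  using assms
proof (induction n rule: nat_induct_non_zero)
  case (Suc n)
  let ?x = "real n" and ?y = "real n + 1"
  have "ln (?x / ?y) \<le> ?x / ?y - 1"
    using Suc by (intro ln_le_minus_one) auto
  also have "\<dots> = - 1 / ?y" by (simp add: field_simps)
  finally have "?y * ln (?x / ?y) \<le> -1"
    using Suc by (simp add: field_simps)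
  hence "exp (?y * ln (?x / ?y)) \<le> exp (-1)" by simp
  also have "exp (?y * ln (?x / ?y)) = (?x / ?y) ^ (n + 1)"
    using Suc exp_of_nat_mult[of "n + 1" "ln (?x / ?y)"] by (simp add: add_ac)
  finally have "(?x / ?y) ^ (n + 1) \<le> exp (-1)" .
  hence "?x ^ (n + 1) / ?y ^ (n + 1) \<le> 1 / exp 1"
    by (simp only: power_divide exp_minus inverse_eq_divide)
  moreover have "exp 1 * a \<le> b" if "a / b \<le> 1 / exp 1" "b > 0" for a b :: real
    using that by (simp add: field_simps)
  ultimately have key: "exp 1 * ?x ^ (n + 1) \<le> ?y ^ (n + 1)"
    by simp
  have "fact (Suc n) = ?y * fact n" by (simp add: add_ac)
  also have "\<dots> \<le> ?y * (exp 1 * ?x * (?x / exp 1) ^ n)"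
    using Suc by (intro mult_left_mono) auto
  also have "\<dots> = ?y * (exp 1 * ?x ^ (n + 1)) / exp 1 ^ n"
    by (simp add: power_divide)
  also have "\<dots> \<le> ?y * ?y ^ (n + 1) / exp 1 ^ n"
    using key by (intro divide_right_mono mult_left_mono) auto
  also have "\<dots> = exp 1 * real (Suc n) * (real (Suc n) / exp 1) ^ (Suc n)"
    by (simp add: power_divide add_ac)
  finally show ?case .
qed auto

lemma R_bounds:
  assumes "0 < z" "z \<le> c * (real k + 1)" "0 < c" "c < 1"
  defines "n \<equiv> real k + 1"
  shows "(exp 1 * z / n) ^ (k + 1) / (exp 1 * n) \<le> R k z"
    and "R k z \<le> (exp 1 * z / n) ^ (k + 1) / (1 - c)"
proof -
  have n: "real (k + 1) = n" "n > 0" by (auto simp: n_def)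
  have "(exp 1 * z / n) ^ (k + 1) / (exp 1 * n) =
          z ^ (k + 1) / (exp 1 * n * (n / exp 1) ^ (k + 1))"
    by (simp add: power_divide power_mult_distrib mult_ac)
  also have "\<dots> \<le> z ^ (k + 1) / fact (k + 1)"
    using assms n(2) fact_le_power_div_exp[of "k + 1", unfolded n(1)]
    by (intro divide_left_mono) (auto intro!: mult_pos_pos simp del: fact_Suc power_Suc)
  also have "\<dots> \<le> R k z"
    using assms by (intro R_ge_first_term) auto
  finally show "(exp 1 * z / n) ^ (k + 1) / (exp 1 * n) \<le> R k z" .
  have "R k z \<le> z ^ (k + 1) / fact (k + 1) / (1 - c)"
    using assms by (intro R_le_first_term) (auto simp: add_ac)
  also have "\<dots> \<le> z ^ (k + 1) / (n / exp 1) ^ (k + 1) / (1 - c)"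
    using assms n(2) power_div_exp_le_fact[of "k + 1", unfolded n(1)]
    by (intro divide_right_mono divide_left_mono)
       (auto intro!: mult_pos_pos simp del: fact_Suc power_Suc)
  also have "\<dots> = (exp 1 * z / n) ^ (k + 1) / (1 - c)"
    by (simp add: power_divide power_mult_distrib)
  finally show "R k z \<le> (exp 1 * z / n) ^ (k + 1) / (1 - c)" .
qed

theorem R_root_asymp:
  fixes z :: "nat \<Rightarrow> real" and c :: real
  assumes z: "\<And>k. z k > 0" and c: "0 < c" "c < 1"
    and le: "\<forall>\<^sub>F k in sequentially. z k \<le> c * (real k + 1)"
  shows "(\<lambda>k. R k (z k) powr (1 / (real k + 1))) \<sim>[sequentially]
           (\<lambda>k. exp 1 * z k / (real k + 1))"
proof (rule asymp_equivI')
  let ?n = "\<lambda>k. real k + 1"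
  let ?q = "\<lambda>k. exp 1 * z k / ?n k"
  let ?r = "\<lambda>k. R k (z k) powr (1 / ?n k) / ?q k"
  have q: "?q k > 0" for k using z[of k] by (auto intro!: divide_pos_pos)
  have root: "(q ^ (k + 1) / a) powr (1 / ?n k) / q = (1 / a) powr (1 / ?n k)"
    if "q > 0" "a > 0" for q a :: real and k
  proof -
    have "q ^ (k + 1) = q powr ?n k"
      using powr_realpow[of q "k + 1"] that by (simp add: add_ac)
    hence "(q ^ (k + 1)) powr (1 / ?n k) = q"
      using that by (simp add: powr_powr add_pos_nonneg[THEN less_imp_neq, symmetric] del: power_Suc)
    thus ?thesis
      using that by (simp add: powr_divide del: power_Suc)
  qed
  have lower: "\<forall>\<^sub>F k in sequentially. (1 / (exp 1 * ?n k)) powr (1 / ?n k) \<le> ?r k"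
    using le
  proof eventually_elim
    case (elim k)
    have "(?q k ^ (k + 1) / (exp 1 * ?n k)) powr (1 / ?n k) / ?q k \<le> ?r k"
      using q[of k] R_bounds(1)[OF z elim c]
      by (intro divide_right_mono powr_mono2) (auto simp del: power_Suc)
    thus ?case using q by (subst (asm) root) auto
  qed
  have upper: "\<forall>\<^sub>F k in sequentially. ?r k \<le> (1 / (1 - c)) powr (1 / ?n k)"
    using le
  proof eventually_elim
    case (elim k)
    have "?r k \<le> (?q k ^ (k + 1) / (1 - c)) powr (1 / ?n k) / ?q k"
      using q[of k] R_bounds(2)[OF z elim c] R_nonneg[of "z k" k] z[of k]
      by (intro divide_right_mono powr_mono2) (auto simp del: power_Suc)
    thus ?case using c q by (subst (asm) root) auto
  qed
  have "(\<lambda>k. (1 / (exp 1 * ?n k)) powr (1 / ?n k)) \<longlonglongrightarrow> 1"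
    by real_asymp
  moreover have "(\<lambda>k. (1 / (1 - c)) powr (1 / ?n k)) \<longlonglongrightarrow> 1"
    using c by real_asymp
  ultimately show "?r \<longlonglongrightarrow> 1"
    using lower upper by (rule tendsto_sandwich[rotated 2])
qed

section \<open>Locating the point where a product with the remainder equals 1\<close>

lemma mult_R_strict_mono:
  assumes "\<And>x. x > 0 \<Longrightarrow> P x > 0"
    and "\<And>x y. 0 < x \<Longrightarrow> x \<le> y \<Longrightarrow> P x \<le> P y"
    and "0 < x" "x < y"
  shows "P x * R k x < P y * R k y"
  using assms R_pos[of x k] R_strict_mono[of x y k]
  by (intro mult_le_less_imp_less) auto

text \<open>By strict monotonicity, a value below 1 at \<open>l n\<close> and a value above 1 at \<open>u n\<close> trap the
  solution of \<open>P x * R k x = 1\<close> between \<open>l n\<close> and \<open>u n\<close>, and by continuity such a solution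
  exists. Letting \<open>l\<close> and \<open>u\<close> tend to \<open>\<theta>\<close> gives the asymptotics. The two hypotheses on
  \<open>\<theta>\<close> are what remains of these comparisons after \<open>R\<close> has been replaced by its bounds.\<close>

lemma inverse_at_1_asymp:
  fixes P :: "real \<Rightarrow> real" and f :: "nat \<Rightarrow> real \<Rightarrow> real" and \<theta> :: real
  assumes f: "\<And>k x. f k x = P x * R k x"
    and cont: "continuous_on {0<..} P"
    and pos: "\<And>x. x > 0 \<Longrightarrow> P x > 0"
    and mono: "\<And>x y. 0 < x \<Longrightarrow> x \<le> y \<Longrightarrow> P x \<le> P y"
    and \<theta>: "0 < \<theta>" "\<theta> < 1"
    and below: "\<And>l. 0 < l \<Longrightarrow> l < \<theta> \<Longrightarrow>
      \<forall>\<^sub>F k in sequentially. P (l * (real k + 1)) * ((exp 1 * l) ^ (k + 1) / (1 - l)) < 1"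
    and above: "\<And>l. \<theta> < l \<Longrightarrow> l < 1 \<Longrightarrow>
      \<forall>\<^sub>F k in sequentially.
        P (l * (real k + 1)) * ((exp 1 * l) ^ (k + 1) / (exp 1 * (real k + 1))) > 1"
  shows "(\<lambda>k. the_inv_into {0<..} (f k) 1) \<sim>[sequentially] (\<lambda>k. \<theta> * (real k + 1))"
proof -
  define x where "x k = the_inv_into {0<..} (f k) 1" for k
  have strict: "f k a < f k b" if "0 < a" "a < b" for k a b
    using mult_R_strict_mono[of P a b k] pos mono that by (simp add: f)
  have inj: "inj_on (f k) {0<..}" for k
    using strict by (intro linorder_inj_onI') (force simp: less_le)+
  have f_below: "\<forall>\<^sub>F k in sequentially. f k (l * (real k + 1)) < 1" if l: "0 < l" "l < \<theta>" for l
    using below[OF l]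
  proof eventually_elim
    case (elim k)
    have "R k (l * (real k + 1)) \<le> (exp 1 * l) ^ (k + 1) / (1 - l)"
      using R_bounds(2)[of "l * (real k + 1)" l k] l \<theta> by simp
    hence "f k (l * (real k + 1)) \<le> P (l * (real k + 1)) * ((exp 1 * l) ^ (k + 1) / (1 - l))"
      unfolding f using l pos[of "l * (real k + 1)"] by (intro mult_left_mono) auto
    with elim show ?case by linarith
  qed
  have f_above: "\<forall>\<^sub>F k in sequentially. f k (l * (real k + 1)) > 1" if l: "\<theta> < l" "l < 1" for l
    using above[OF l]
  proof eventually_elim
    case (elim k)
    have "(exp 1 * l) ^ (k + 1) / (exp 1 * (real k + 1)) \<le> R k (l * (real k + 1))"
      using R_bounds(1)[of "l * (real k + 1)" l k] l \<theta> by simp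
    hence "P (l * (real k + 1)) * ((exp 1 * l) ^ (k + 1) / (exp 1 * (real k + 1)))
             \<le> f k (l * (real k + 1))"
      unfolding f using l \<theta> pos[of "l * (real k + 1)"] by (intro mult_left_mono) auto
    with elim show ?case by linarith
  qed
  have trapped: "\<forall>\<^sub>F k in sequentially. l < x k / (real k + 1) \<and> x k / (real k + 1) < u"
    if lu: "0 < l" "l < \<theta>" "\<theta> < u" "u < 1" for l u
    using f_below[OF lu(1,2)] f_above[OF lu(3,4)]
  proof eventually_elim
    case (elim k)
    let ?l = "l * (real k + 1)" and ?u = "u * (real k + 1)"
    have l: "0 < ?l" "?l \<le> ?u" using lu by auto
    have "continuous_on {?l..?u} (f k)"
      unfolding f using l
      by (intro continuous_intros continuous_on_R continuous_on_subset[OF cont]) auto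
    with elim l obtain y where y: "?l \<le> y" "y \<le> ?u" "f k y = 1"
      using IVT'[of "f k" ?l 1 ?u] by auto
    have "x k = y"
      unfolding x_def using y l the_inv_into_f_f[OF inj, of y k] by auto
    moreover have "y \<noteq> ?l" "y \<noteq> ?u" using elim y by auto
    ultimately show ?case using y by (auto simp: field_simps)
  qed
  have "(\<lambda>k. x k / (real k + 1)) \<longlonglongrightarrow> \<theta>"
  proof (rule order_tendstoI)
    fix a assume "a < \<theta>"
    hence "max a (\<theta> / 2) < \<theta>" "0 < max a (\<theta> / 2)" using \<theta> by auto
    from trapped[OF this(2,1), of "(\<theta> + 1) / 2"] \<theta>
    show "\<forall>\<^sub>F k in sequentially. a < x k / (real k + 1)"
      by (auto elim!: eventually_mono)
  next
    fix a assume "\<theta> < a"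
    hence "\<theta> < min a ((\<theta> + 1) / 2)" "min a ((\<theta> + 1) / 2) < 1"
      using \<theta> by (auto simp: min_less_iff_disj)
    from trapped[OF _ _ this, of "\<theta> / 2"] \<theta>
    show "\<forall>\<^sub>F k in sequentially. x k / (real k + 1) < a"
      by (auto elim!: eventually_mono)
  qed
  hence "(\<lambda>k. x k / (real k + 1) / \<theta>) \<longlonglongrightarrow> \<theta> / \<theta>"
    using \<theta> by (intro tendsto_divide) auto
  thus ?thesis
    using \<theta> unfolding x_def by (intro asymp_equivI') (simp add: mult.commute)
qed

section \<open>The inverses of \<open>h\<close> and \<open>g\<close> at 1\<close>

lemma mult_exp_strict_mono: "0 \<le> v \<Longrightarrow> v < w \<Longrightarrow> v * exp v < w * exp (w::real)"
  by (intro mult_strict_mono) auto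

lemma lambert_W:
  assumes "y > 0"
  shows "lambert_W y > 0" "lambert_W y * exp (lambert_W y) = y"
proof -
  have "y * 1 \<le> y * exp y" using assms by (intro mult_left_mono) auto
  moreover have "continuous_on {0..y} (\<lambda>w. w * exp w)" by (intro continuous_intros)
  ultimately obtain w where w: "0 \<le> w" "w * exp w = y"
    using IVT'[of "\<lambda>w. w * exp w" 0 y y] assms by auto
  with assms have "w > 0" by (cases "w = 0") auto
  moreover have "v = w" if "v > 0" "v * exp v = y" for v
    using mult_exp_strict_mono[of v w] mult_exp_strict_mono[of w v] that w
    by (cases v w rule: linorder_cases) auto
  ultimately have "\<exists>!w. w > 0 \<and> w * exp w = y"
    using w by (intro ex1I[of _ w]) blast+
  from theI'[OF this] show "lambert_W y > 0" "lambert_W y * exp (lambert_W y) = y"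
    unfolding lambert_W_def by auto
qed

lemma lambert_W_less_self: "y > 0 \<Longrightarrow> lambert_W y < y"
  using lambert_W[of y] mult_strict_left_mono[of 1 "exp (lambert_W y)" "lambert_W y"] by simp

lemma H_1_asymp: "(\<lambda>k. H k 1) \<sim>[sequentially] (\<lambda>k. lambert_W (1 / exp 1) * (real k + 1))"
  unfolding H_def
proof (rule inverse_at_1_asymp[where P = exp])
  let ?w = "lambert_W (1 / exp 1)"
  have w: "?w > 0" "?w * exp ?w = 1 / exp 1" "?w < 1 / exp 1"
    by (simp_all add: lambert_W lambert_W_less_self)
  show "0 < ?w" by fact
  have "1 / exp 1 < (1 :: real)" by simp
  with w show w1: "?w < 1" by linarith
  have collect: "exp (l * (real k + 1)) * (exp 1 * l) ^ (k + 1) = (exp 1 * (l * exp l)) ^ (k + 1)"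
    for l :: real and k
    using exp_of_nat_mult[of "k + 1" l] by (simp add: power_mult_distrib mult_ac add_ac)
  show "\<forall>\<^sub>F k in sequentially. exp (l * (real k + 1)) * ((exp 1 * l) ^ (k + 1) / (1 - l)) < 1"
    if l: "0 < l" "l < ?w" for l
  proof -
    have l1: "l < 1" using l w1 by linarith
    define q where "q = exp 1 * (l * exp l)"
    have "l * exp l < 1 / exp 1" using mult_exp_strict_mono[of l ?w] l w by simp
    hence q: "0 < q" "q < 1" using l by (auto simp: q_def field_simps)
    have "(\<lambda>k. q ^ (k + 1) / (1 - l)) \<longlonglongrightarrow> 0"
      using q l1 by real_asymp
    from order_tendstoD(2)[OF this, of 1] show ?thesis
      by (simp only: times_divide_eq_right collect q_def)
  qed
  show "\<forall>\<^sub>F k in sequentially.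
      exp (l * (real k + 1)) * ((exp 1 * l) ^ (k + 1) / (exp 1 * (real k + 1))) > 1"
    if l: "?w < l" "l < 1" for l
  proof -
    define q where "q = exp 1 * (l * exp l)"
    have "1 / exp 1 < l * exp l" using mult_exp_strict_mono[of ?w l] l w by simp
    hence q: "q > 1" by (simp add: q_def field_simps)
    have "\<forall>\<^sub>F k in sequentially. q ^ (k + 1) / (exp 1 * (real k + 1)) > 1"
      using q by real_asymp
    thus ?thesis
      by (simp only: times_divide_eq_right collect q_def)
  qed
qed (auto simp: h_def intro!: continuous_intros)

lemma sigma_star_pos: "d > 0 \<Longrightarrow> z > 0 \<Longrightarrow> sigma_star d z > 0"
  unfolding sigma_star_def by (intro divide_pos_pos add_pos_nonneg) auto

lemma sigma_star_mono: "d > 0 \<Longrightarrow> 0 < x \<Longrightarrow> x \<le> y \<Longrightarrow> sigma_star d x \<le> sigma_star d y"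
  unfolding sigma_star_def
  by (intro divide_right_mono add_mono real_sqrt_le_mono mult_mono) auto

lemma sigma_star_le:
  assumes "d \<ge> 1" "z > 0"
  shows "sigma_star d z \<le> 2 * z + 1"
proof -
  have "sqrt (z * (d + z)) \<le> sqrt ((d + z) ^ 2)"
    using assms by (intro real_sqrt_le_mono) (auto simp: power2_eq_square intro!: mult_right_mono)
  hence "sqrt (z * (d + z)) \<le> d + z" using assms by simp
  moreover have "z * 1 \<le> z * d" using assms by (intro mult_left_mono) auto
  ultimately have "z + sqrt (z * (d + z)) \<le> (2 * z + 1) * d" by (simp add: algebra_simps)
  thus ?thesis using assms by (simp add: sigma_star_def field_simps)
qed

text \<open>In this form \<open>z / \<sigma>\<^sup>*\<close> is visibly increasing in \<open>z\<close> and bounded by \<open>d\<close>.\<close>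

lemma div_sigma_star:
  assumes "d > 0" "z > 0"
  shows "z / sigma_star d z = d / (1 + sqrt (1 + d / z))"
proof -
  have "z * (d + z) = z ^ 2 * (1 + d / z)" using assms by (simp add: power2_eq_square field_simps)
  hence "sqrt (z * (d + z)) = z * sqrt (1 + d / z)" using assms by (simp add: real_sqrt_mult)
  hence "sigma_star d z = z * (1 + sqrt (1 + d / z)) / d"
    by (simp add: sigma_star_def algebra_simps)
  thus ?thesis using assms by simp
qed

definition g_factor :: "real \<Rightarrow> real \<Rightarrow> real" where
  "g_factor d z = (1 + 2 * sigma_star d z) powr (d / 2) * exp (z / sigma_star d z)"

lemma continuous_on_g_factor:
  assumes "d > 0"
  shows "continuous_on {0<..} (g_factor d)"
proof -
  have s: "continuous_on {0<..} (sigma_star d)"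
    unfolding sigma_star_def using assms by (intro continuous_intros) auto
  have "1 + 2 * sigma_star d z \<noteq> 0" "sigma_star d z \<noteq> 0" if "z \<in> {0<..}" for z
    using sigma_star_pos[of d z] assms that by auto
  thus ?thesis
    unfolding g_factor_def by (intro continuous_intros s) auto
qed

lemma g_factor_mono:
  assumes "d > 0" "0 < x" "x \<le> y"
  shows "g_factor d x \<le> g_factor d y"
proof -
  have "d / y \<le> d / x" using assms by (intro divide_left_mono) auto
  hence "d / (1 + sqrt (1 + d / x)) \<le> d / (1 + sqrt (1 + d / y))"
    using assms by (intro divide_left_mono) (auto intro!: mult_pos_pos add_pos_nonneg)
  hence "exp (x / sigma_star d x) \<le> exp (y / sigma_star d y)"
    using assms by (simp add: div_sigma_star)
  moreover have "(1 + 2 * sigma_star d x) powr (d / 2) \<le> (1 + 2 * sigma_star d y) powr (d / 2)"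
    using assms sigma_star_mono[of d x y] sigma_star_pos[of d x]
    by (intro powr_mono2) auto
  ultimately show ?thesis unfolding g_factor_def by (intro mult_mono) auto
qed

lemma g_factor_ge_1:
  assumes "d > 0" "z > 0"
  shows "g_factor d z \<ge> 1"
proof -
  have "1 * 1 \<le> (1 + 2 * sigma_star d z) powr (d / 2) * exp (z / sigma_star d z)"
    using assms sigma_star_pos[of d z] by (intro mult_mono ge_one_powr_ge_zero) auto
  thus ?thesis by (simp add: g_factor_def)
qed

lemma g_factor_le:
  assumes "d \<ge> 1" "z > 0"
  shows "g_factor d z \<le> (4 * z + 3) powr (d / 2) * exp d"
proof -
  have "d / (1 + sqrt (1 + d / z)) \<le> d / 1"
    using assms by (intro divide_left_mono) (auto intro!: add_pos_nonneg)
  hence "exp (z / sigma_star d z) \<le> exp d" using assms by (simp add: div_sigma_star)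
  moreover have "(1 + 2 * sigma_star d z) powr (d / 2) \<le> (4 * z + 3) powr (d / 2)"
    using assms sigma_star_le[of d z] sigma_star_pos[of d z] by (intro powr_mono2) auto
  ultimately show ?thesis unfolding g_factor_def by (intro mult_mono) auto
qed

lemma G_1_asymp:
  assumes "d \<ge> 1"
  shows "(\<lambda>k. G k d 1) \<sim>[sequentially] (\<lambda>k. 1 / exp 1 * (real k + 1))"
  unfolding G_def
proof (rule inverse_at_1_asymp[where P = "g_factor d"])
  have d: "d > 0" using assms by simp
  show "g k d x = g_factor d x * R k x" for k x by (simp add: g_def g_factor_def)
  show "continuous_on {0<..} (g_factor d)" using d by (rule continuous_on_g_factor)
  show "g_factor d x > 0" if "x > 0" for x using g_factor_ge_1[OF d that] by linarith
  show "g_factor d x \<le> g_factor d y" if "0 < x" "x \<le> y" for x y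
    using d that by (rule g_factor_mono)
  show "\<forall>\<^sub>F k in sequentially.
      g_factor d (l * (real k + 1)) * ((exp 1 * l) ^ (k + 1) / (1 - l)) < 1"
    if l: "0 < l" "l < 1 / exp 1" for l
  proof -
    have "1 / exp 1 < (1 :: real)" by simp
    with l have l1: "l < 1" by linarith
    define q where "q = exp 1 * l"
    have q: "0 < q" "q < 1" using l by (auto simp: q_def field_simps)
    have "(\<lambda>k. (4 * (l * (real k + 1)) + 3) powr (d / 2) * exp d * (q ^ (k + 1) / (1 - l))) \<longlonglongrightarrow> 0"
      using q l(1) l1 d by real_asymp
    hence "\<forall>\<^sub>F k in sequentially.
        (4 * (l * (real k + 1)) + 3) powr (d / 2) * exp d * (q ^ (k + 1) / (1 - l)) < 1"
      by (rule order_tendstoD) simp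
    thus ?thesis
    proof eventually_elim
      case (elim k)
      have "g_factor d (l * (real k + 1)) * (q ^ (k + 1) / (1 - l)) \<le>
          (4 * (l * (real k + 1)) + 3) powr (d / 2) * exp d * (q ^ (k + 1) / (1 - l))"
        using assms l l1 q by (intro mult_right_mono g_factor_le) auto
      with elim show ?case unfolding q_def by linarith
    qed
  qed
  show "\<forall>\<^sub>F k in sequentially.
      g_factor d (l * (real k + 1)) * ((exp 1 * l) ^ (k + 1) / (exp 1 * (real k + 1))) > 1"
    if l: "1 / exp 1 < l" "l < 1" for l
  proof -
    have l0: "l > 0" using l(1) by (rule less_trans[rotated]) simp
    define q where "q = exp 1 * l"
    have q: "q > 1" using l by (auto simp: q_def field_simps)
    have "\<forall>\<^sub>F k in sequentially. q ^ (k + 1) / (exp 1 * (real k + 1)) > 1"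
      using q by real_asymp
    thus ?thesis
    proof eventually_elim
      case (elim k)
      have "1 * (q ^ (k + 1) / (exp 1 * (real k + 1))) \<le>
          g_factor d (l * (real k + 1)) * (q ^ (k + 1) / (exp 1 * (real k + 1)))"
        using d l0 q by (intro mult_right_mono g_factor_ge_1) auto
      with elim show ?case unfolding q_def by linarith
    qed
  qed
qed auto

section \<open>The four asymptotics\<close>

text \<open>Two sequences growing linearly: the one with the larger slope is eventually the maximum.\<close>

lemma max_asymp_equiv_linear:
  fixes a b :: "nat \<Rightarrow> real" and s t :: real
  assumes a: "a \<sim>[sequentially] (\<lambda>k. s * (real k + 1))"
    and b: "b \<sim>[sequentially] (\<lambda>k. t * (real k + 1))"
    and st: "0 < s" "s < t"
  shows "(\<lambda>k. max (a k) (b k)) \<sim>[sequentially] (\<lambda>k. t * (real k + 1))"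
proof -
  have slope: "(\<lambda>k. f k / (real k + 1)) \<longlonglongrightarrow> r"
    if "f \<sim>[sequentially] (\<lambda>k. r * (real k + 1))" for f :: "nat \<Rightarrow> real" and r :: real
  proof (rule asymp_equiv_tendsto_transfer)
    show "(\<lambda>k. r * (real k + 1) / (real k + 1)) \<sim>[sequentially] (\<lambda>k. f k / (real k + 1))"
      using that by (intro asymp_equiv_intros) (simp add: asymp_equiv_sym)
    show "(\<lambda>k. r * (real k + 1) / (real k + 1)) \<longlonglongrightarrow> r"
      by (simp add: add_pos_nonneg[THEN less_imp_neq, symmetric])
  qed
  obtain m where m: "s < m" "m < t" using dense[OF st(2)] by auto
  have "\<forall>\<^sub>F k in sequentially. b k = max (a k) (b k)"
    using order_tendstoD(2)[OF slope[OF a] m(1)] order_tendstoD(1)[OF slope[OF b] m(2)]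
  proof eventually_elim
    case (elim k)
    hence "a k / (real k + 1) < b k / (real k + 1)" by linarith
    thus ?case by (simp add: divide_less_cancel)
  qed
  from asymp_equiv_transfer[OF b this] show ?thesis by simp
qed

theorem lemma3p3:
  fixes d :: real
  assumes "d \<ge> 1"
  shows
    "(\<forall>(z :: nat \<Rightarrow> real) (c :: real).
        (\<forall>k. z k > 0) \<longrightarrow> 0 < c \<longrightarrow> c < 1 \<longrightarrow>
        (\<forall>\<^sub>F k in sequentially. z k \<le> c * (real k + 1)) \<longrightarrow>
        (\<lambda>k. R k (z k) powr (1 / (real k + 1))) \<sim>[sequentially]
          (\<lambda>k. exp 1 * z k / (real k + 1)))
     \<and> (\<lambda>k. H k 1) \<sim>[sequentially] (\<lambda>k. lambert_W (1 / exp 1) * (real k + 1))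
     \<and> (\<lambda>k. G k d 1) \<sim>[sequentially] (\<lambda>k. 1 / exp 1 * (real k + 1))
     \<and> (\<lambda>k. C k d) \<sim>[sequentially] (\<lambda>k. 1 / exp 1 * (real k + 1))"
proof (intro conjI allI impI)
  show "(\<lambda>k. C k d) \<sim>[sequentially] (\<lambda>k. 1 / exp 1 * (real k + 1))"
    unfolding C_def
    by (rule max_asymp_equiv_linear[OF H_1_asymp G_1_asymp[OF assms]])
       (simp_all add: lambert_W lambert_W_less_self)
qed (use R_root_asymp H_1_asymp G_1_asymp[OF assms] in auto)

end
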